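(* Let $n\ge 1$, $k\ge 2$ and $c$ be integers. For a positive integer $m$, let $\mathbb{Z}_m^{**}=\{u\in\{0,1,\dots,m-1\}: \gcd(u,m)=\gcd(1-u,m)=1\}$ be the set of exceptional units of $\mathbb{Z}_m$, and let $$\mathcal{N}_{k,c,2}(n)=\big|\{(x_1,\dots,x_k)\in(\mathbb{Z}_n^{**})^k : x_1^2+\cdots+x_k^2\equiv c \pmod n\}\big|.$$ If $n$ is even, then $\mathcal{N}_{k,c,2}(n)=0$. If $n$ is odd, then \begin{align*} \mathcal{N}_{k,c,2}(n) =&(-1)^{k\omega(n)}\prod_{p\mid n}p^{k\nu_p(n)-\nu_p(n)-k} \Bigg((2-p)^k-\sum_{i=0}^{\lfloor\frac{k}{2}\rfloor} (-1)^{\frac{(p-1)i}{2}}p^{i}\binom{k}{2i}\Big(2^{k-2i} -p\sum_{\substack{j=0\\ p\mid(j-c)}}^{k-2i}\binom{k-2i}{j}\Big)\\ &-\sum_{i=0}^{\lfloor\frac{k-1}{2}\rfloor} (-1)^{\frac{(p-1)(i+1)}{2}}p^{i+1}\binom{k}{2i+1} \sum_{\substack{j=0\\ p\nmid(j-c)}}^{k-2i-1} \binom{k-2i-1}{j}\Big(\frac{j-c}{p}\Big)\Bigg), \end{align*} where the product runs over the distinct primes $p$ dividing $n$.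
   Context: $\omega(n)$ denotes the number of distinct prime divisors of $n$; $\nu_p(n)$ denotes the $p$-adic valuation of $n$ (the exponent of $p$ in $n$); $\big(\frac{x}{p}\big)$ is the Legendre symbol; $\binom{y}{z}=\frac{y!}{z!(y-z)!}$ with $\binom{0}{0}=1$. For $n=1$ the empty product equals $1$. *)

theory Defs
  imports Complex_Main "HOL-Number_Theory.Number_Theory" "HOL-Library.FuncSet"
begin

definition exceptional_units :: "nat \<Rightarrow> int set" where
  "exceptional_units m =
     {u \<in> {0..<int m}. gcd u (int m) = 1 \<and> gcd (1 - u) (int m) = 1}"

(* A k-tuple is an extensional function on the index set {1..k}, so that distinct
   functions in the set are distinct tuples. *)
definition num_square_sums :: "nat \<Rightarrow> int \<Rightarrow> nat \<Rightarrow> nat" where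
  "num_square_sums k c n =
     card {x \<in> {1..k} \<rightarrow>\<^sub>E exceptional_units n. [(\<Sum>i=1..k. x i ^ 2) = c] (mod int n)}"

definition omega :: "nat \<Rightarrow> nat" where
  "omega n = card {p. prime p \<and> p dvd n}"

end

theory Submission
  imports Defs
begin

text \<open>
  Both reductions to prime moduli go by induction on \<open>k\<close>, splitting off one coordinate:
  the Chinese remainder theorem gives multiplicativity in \<open>n\<close>, and lifting from
  \<open>p ^ a\<close> to \<open>p ^ (a + 1)\<close> multiplies the count by \<open>p ^ (k - 1)\<close>, where Hensel's
  argument is needed only for \<open>k = 1\<close> (units are nonsingular solutions since \<open>p\<close> is odd).

  Modulo \<open>p\<close>, orthogonality of the additive characters \<open>e\<close> gives
  \<open>p * N = (\<Sum>t. e (- c * t) * S t ^ k)\<close>, where \<open>S t\<close> is the sum of \<open>e (t * x\<^sup>2)\<close> over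
  \<open>x \<noteq> 0, 1\<close>. For \<open>t \<noteq> 0\<close> it equals \<open>(t/p) G - 1 - e t\<close> with \<open>G\<close> the quadratic Gauss sum.
  Expanding the \<open>k\<close>-th power, the even powers of \<open>G\<close> come from \<open>G\<^sup>2 = (- 1) ^ ((p - 1) / 2) p\<close>;
  in the terms with an odd power the sum over \<open>t\<close> contributes one more factor \<open>G\<close>.
\<close>

section \<open>Reduction to prime moduli\<close>

lemma finite_exceptional_units [simp]: "finite (exceptional_units m)"
  by (rule finite_subset[of _ "{0..<int m}"]) (auto simp: exceptional_units_def)

lemma mem_exceptional_units_iff:
  "u \<in> exceptional_units m \<longleftrightarrow>
     0 \<le> u \<and> u < int m \<and> coprime u (int m) \<and> coprime (1 - u) (int m)"
  by (auto simp: exceptional_units_def coprime_iff_gcd_eq_1)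

lemma exceptional_units_mod_mem:
  assumes "0 < a" "a dvd n" "u \<in> exceptional_units n"
  shows "u mod int a \<in> exceptional_units a"
proof -
  have d: "int a dvd int n" using assms by simp
  have "coprime u (int a)" "coprime (1 - u) (int a)"
    using assms d by (auto simp: mem_exceptional_units_iff intro: coprime_divisors[OF dvd_refl])
  moreover have "gcd (1 - u mod int a) (int a) = gcd (1 - u) (int a)"
    by (metis gcd_mod_left gcd.commute mod_diff_right_eq gcd_red_int)
  ultimately show ?thesis using assms(1)
    by (auto simp: mem_exceptional_units_iff coprime_iff_gcd_eq_1)
qed

text \<open>The only 0-tuple has the empty sum 0. This is the base case of the inductions on
  \<open>k\<close> below, where it turns into a divisibility fact about \<open>c\<close>.\<close>

lemma num_square_sums_0: "num_square_sums 0 c n = (if int n dvd c then 1 else 0)"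
  by (auto simp: num_square_sums_def cong_iff_dvd_diff)

lemma num_square_sums_cong:
  assumes "[c = d] (mod int n)"
  shows "num_square_sums k c n = num_square_sums k d n"
proof -
  have "[s = c] (mod int n) \<longleftrightarrow> [s = d] (mod int n)" for s
    using assms cong_trans cong_sym by blast
  thus ?thesis by (simp add: num_square_sums_def)
qed

text \<open>Fixing the last coordinate \<open>u\<close> leaves the same problem with target
  \<open>c - u^2\<close>. Since the target changes, every induction on \<open>k\<close> that uses
  this generalizes over \<open>c\<close>.\<close>

lemma num_square_sums_Suc:
  "num_square_sums (Suc k) c n = (\<Sum>u\<in>exceptional_units n. num_square_sums k (c - u^2) n)"
proof -
  let ?E = "exceptional_units n"
  let ?A = "\<lambda>u. {x \<in> {1..k} \<rightarrow>\<^sub>E ?E. [(\<Sum>i=1..k. x i ^ 2) = c - u^2] (mod int n)}"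
  let ?f = "\<lambda>(u, g). g(Suc k := u)"
  have ins: "{1..Suc k} = insert (Suc k) {1..k}" by auto
  have sum_upd: "(\<Sum>i=1..Suc k. (g(Suc k := u)) i ^ 2) = (\<Sum>i=1..k. g i ^ 2) + u^2" for g and u :: int
    by simp
  have cong: "[s + u^2 = c] (mod int n) \<longleftrightarrow> [s = c - u^2] (mod int n)" for s u :: int
    by (simp add: cong_iff_dvd_diff algebra_simps)
  have "{x \<in> {1..Suc k} \<rightarrow>\<^sub>E ?E. [(\<Sum>i=1..Suc k. x i ^ 2) = c] (mod int n)} = ?f ` (SIGMA u:?E. ?A u)"
    (is "?L = ?R")
  proof (intro equalityI subsetI)
    fix x assume "x \<in> ?L"
    then obtain u g where "u \<in> ?E" "g \<in> {1..k} \<rightarrow>\<^sub>E ?E" "x = g(Suc k := u)"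
      and "[(\<Sum>i=1..Suc k. x i ^ 2) = c] (mod int n)"
      unfolding ins PiE_insert_eq by auto
    moreover from this have "[(\<Sum>i=1..k. g i ^ 2) = c - u^2] (mod int n)"
      by (simp only: sum_upd cong)
    ultimately show "x \<in> ?R" by (intro image_eqI[of _ _ "(u, g)"]) auto
  next
    fix x assume "x \<in> ?R"
    then obtain u g where "u \<in> ?E" "g \<in> ?A u" "x = g(Suc k := u)" by auto
    moreover from this have "[(\<Sum>i=1..Suc k. x i ^ 2) = c] (mod int n)"
      by (simp only: sum_upd cong mem_Collect_eq)
    moreover have "x \<in> {1..Suc k} \<rightarrow>\<^sub>E ?E"
      unfolding ins PiE_insert_eq using calculation by auto
    ultimately show "x \<in> ?L" by simp
  qed
  moreover have "inj_on ?f (SIGMA u:?E. ?A u)"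
    using inj_combinator[of "Suc k" "{1..k}" "\<lambda>_. ?E"] by (rule inj_on_subset) auto
  ultimately have "num_square_sums (Suc k) c n = card (SIGMA u:?E. ?A u)"
    by (simp add: num_square_sums_def card_image)
  also have "\<dots> = (\<Sum>u\<in>?E. card (?A u))"
    by (rule card_SigmaI) (auto intro!: finite_subset[OF Collect_subset] finite_PiE)
  finally show ?thesis by (simp add: num_square_sums_def)
qed

section \<open>Multiplicativity in the modulus\<close>

lemma bij_betw_exceptional_units_mult:
  assumes "0 < a" "0 < b" "coprime a b"
  shows "bij_betw (\<lambda>u. (u mod int a, u mod int b)) (exceptional_units (a * b))
           (exceptional_units a \<times> exceptional_units b)"
proof (rule bij_betw_imageI)
  show "inj_on (\<lambda>u. (u mod int a, u mod int b)) (exceptional_units (a * b))"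
  proof (rule inj_onI)
    fix u v assume uv: "u \<in> exceptional_units (a * b)" "v \<in> exceptional_units (a * b)"
      and "(u mod int a, u mod int b) = (v mod int a, v mod int b)"
    hence "[u = v] (mod int a)" "[u = v] (mod int b)" by (auto simp: cong_def)
    hence "[u = v] (mod int a * int b)" using assms by (intro coprime_cong_mult) auto
    thus "u = v" using uv by (auto simp: mem_exceptional_units_iff cong_def)
  qed
next
  show "(\<lambda>u. (u mod int a, u mod int b)) ` exceptional_units (a * b) =
          exceptional_units a \<times> exceptional_units b" (is "?f ` _ = _")
  proof (intro equalityI subsetI)
    fix w assume "w \<in> ?f ` exceptional_units (a * b)"
    thus "w \<in> exceptional_units a \<times> exceptional_units b"
      using exceptional_units_mod_mem[of a "a * b"] exceptional_units_mod_mem[of b "a * b"] assms by auto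
  next
    fix w assume "w \<in> exceptional_units a \<times> exceptional_units b"
    then obtain v w' where w: "w = (v, w')" "v \<in> exceptional_units a" "w' \<in> exceptional_units b"
      by auto
    obtain x where x: "[x = v] (mod int a)" "[x = w'] (mod int b)"
      using binary_chinese_remainder_int[of "int a" "int b" v w'] assms by auto
    define u where "u = x mod (int a * int b)"
    have ua: "[u = v] (mod int a)" and ub: "[u = w'] (mod int b)"
      using x unfolding u_def by (simp_all add: cong_def mod_mod_cancel)
    have cop: "coprime u (int a)" "coprime (1 - u) (int a)" "coprime u (int b)" "coprime (1 - u) (int b)"
      using w(2,3) cong_imp_coprime[OF cong_sym[OF ua]] cong_imp_coprime[OF cong_sym[OF ub]]
        cong_imp_coprime[OF cong_diff[OF cong_refl[of 1] cong_sym[OF ua]]]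
        cong_imp_coprime[OF cong_diff[OF cong_refl[of 1] cong_sym[OF ub]]]
      by (auto simp: mem_exceptional_units_iff)
    have "u \<in> exceptional_units (a * b)"
      using cop assms by (auto simp: mem_exceptional_units_iff u_def)
    moreover have "?f u = w"
      using ua ub w by (auto simp: mem_exceptional_units_iff cong_def)
    ultimately show "w \<in> ?f ` exceptional_units (a * b)" by force
  qed
qed

text \<open>After the induction hypothesis each summand is a function of \<open>u mod a\<close>
  times a function of \<open>u mod b\<close>. These two residues vary independently by the Chinese
  remainder theorem, so the sum factors.\<close>

lemma num_square_sums_mult:
  assumes "0 < a" "0 < b" "coprime a b"
  shows "num_square_sums k c (a * b) = num_square_sums k c a * num_square_sums k c b"
proof (induction k arbitrary: c)
  case 0
  have "int a * int b dvd c \<longleftrightarrow> int a dvd c \<and> int b dvd c"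
    using assms by (auto intro: divides_mult dest: dvd_mult_left dvd_mult_right)
  thus ?case by (simp add: num_square_sums_0)
next
  case (Suc k)
  have red: "num_square_sums k (c - u^2) m = num_square_sums k (c - (u mod int m)^2) m" for u m
    by (intro num_square_sums_cong cong_diff cong_refl cong_pow) (simp add: cong_def)
  have "num_square_sums (Suc k) c (a * b) =
      (\<Sum>u\<in>exceptional_units (a * b).
        num_square_sums k (c - (u mod int a)^2) a * num_square_sums k (c - (u mod int b)^2) b)"
    by (simp add: num_square_sums_Suc Suc.IH flip: red)
  also have "\<dots> = (\<Sum>(v, w)\<in>exceptional_units a \<times> exceptional_units b.
        num_square_sums k (c - v^2) a * num_square_sums k (c - w^2) b)"
    using sum.reindex_bij_betw[OF bij_betw_exceptional_units_mult[OF assms],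
        of "\<lambda>(v, w). num_square_sums k (c - v^2) a * num_square_sums k (c - w^2) b"] by simp
  finally show ?case
    by (simp add: num_square_sums_Suc sum_product sum.cartesian_product)
qed

lemma num_square_sums_1_right: "num_square_sums k c 1 = 1"
proof -
  have "exceptional_units 1 = {0}" by (auto simp: mem_exceptional_units_iff)
  thus ?thesis
    by (induction k arbitrary: c) (simp_all add: num_square_sums_0 num_square_sums_Suc)
qed

lemma num_square_sums_prod_prime_powers:
  assumes "0 < n"
  shows "num_square_sums k c n =
    (\<Prod>p | prime p \<and> p dvd n. num_square_sums k c (p ^ multiplicity p n))"
proof -
  have "num_square_sums k c (\<Prod>p\<in>P. p ^ e p) = (\<Prod>p\<in>P. num_square_sums k c (p ^ e p))"
    if "finite P" "\<And>p. p \<in> P \<Longrightarrow> prime p" for P :: "nat set" and e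
    using that
  proof (induction P rule: finite_induct)
    case empty
    thus ?case using num_square_sums_1_right by simp
  next
    case (insert p P)
    have "coprime (p ^ e p) (\<Prod>q\<in>P. q ^ e q)"
      using insert by (intro prod_coprime_right) (metis coprime_power_left_iff coprime_power_right_iff insertI1 insertI2 primes_coprime)
    moreover have "0 < p ^ e p" "0 < (\<Prod>q\<in>P. q ^ e q)"
      using insert.prems by (auto intro!: prod_pos simp: prime_gt_0_nat)
    ultimately show ?case using insert by (simp add: num_square_sums_mult)
  qed
  from this[of "prime_factors n" "\<lambda>p. multiplicity p n"]
  have "num_square_sums k c (\<Prod>p\<in>prime_factors n. p ^ multiplicity p n) =
    (\<Prod>p\<in>prime_factors n. num_square_sums k c (p ^ multiplicity p n))" by auto
  moreover have "prime_factors n = {p. prime p \<and> p dvd n}"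
    using assms by (auto simp: prime_factors_dvd)
  ultimately show ?thesis using prime_factorization_nat[OF assms] by simp
qed

text \<open>One of \<open>u\<close> and \<open>1 - u\<close> is even and so shares the factor 2 with
  \<open>n\<close>: there are no exceptional units. At least one coordinate is required, as the
  empty tuple may still count.\<close>

lemma num_square_sums_even:
  assumes "even n" "k \<ge> 1"
  shows "num_square_sums k c n = 0"
proof -
  have "exceptional_units n = {}"
  proof (rule ccontr)
    assume "exceptional_units n \<noteq> {}"
    then obtain u where u: "coprime u (int n)" "coprime (1 - u) (int n)"
      by (auto simp: mem_exceptional_units_iff)
    have "even u \<or> even (1 - u)" by auto
    thus False using u assms(1) by (metis coprime_common_divisor even_of_nat odd_one)
  qed
  thus ?thesis using assms(2) by (cases k) (auto simp: num_square_sums_Suc)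
qed

section \<open>Lifting solutions from \<open>p ^ a\<close> to \<open>p ^ (a + 1)\<close>\<close>

context
  fixes p a :: nat
  assumes prime_p: "prime p" and odd_p: "odd p" and pos_a: "0 < a"
begin

lemma exceptional_units_prime_power_cong:
  assumes "0 < b" "[u = v] (mod int p ^ a)" "coprime v (int (p ^ b))" "coprime (1 - v) (int (p ^ b))"
  shows "coprime u (int (p ^ a))" "coprime (1 - u) (int (p ^ a))"
proof -
  have "coprime v (int p ^ a)" "coprime (1 - v) (int p ^ a)"
    using assms(1,3,4) by auto
  thus "coprime u (int (p ^ a))" "coprime (1 - u) (int (p ^ a))"
    using cong_imp_coprime[OF cong_sym[OF assms(2)]]
      cong_imp_coprime[OF cong_diff[OF cong_refl[of 1] cong_sym[OF assms(2)]]] by auto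
qed

text \<open>Here \<open>j\<close> is the new leading digit in base \<open>p\<close>. Being an
  exceptional unit depends only on the residue modulo \<open>p\<close>, so \<open>j\<close> is
  unrestricted.\<close>

lemma bij_betw_exceptional_units_prime_power_Suc:
  "bij_betw (\<lambda>(u, j). u + int p ^ a * j) (exceptional_units (p ^ a) \<times> {0..<int p})
     (exceptional_units (p ^ Suc a))"
proof (rule bij_betwI[where g = "\<lambda>u. (u mod int p ^ a, u div int p ^ a)"])
  have p0: "0 < int p" using prime_p prime_gt_0_nat by simp
  let ?q = "int p ^ a"
  have q0: "0 < ?q" using p0 by simp
  show "(\<lambda>(u, j). u + ?q * j) \<in> exceptional_units (p ^ a) \<times> {0..<int p} \<rightarrow> exceptional_units (p ^ Suc a)"
  proof (clarsimp simp del: power_Suc)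
    fix u j assume u: "u \<in> exceptional_units (p ^ a)" and j: "0 \<le> j" "j < int p"
    have "[u + ?q * j = u] (mod ?q)" by (simp add: cong_iff_dvd_diff)
    from exceptional_units_prime_power_cong[OF pos_a this]
    have "coprime (u + ?q * j) (int (p ^ a))" "coprime (1 - (u + ?q * j)) (int (p ^ a))"
      using u by (auto simp: mem_exceptional_units_iff)
    moreover have "u + ?q * j < ?q * int p"
    proof -
      have "u + ?q * j < ?q * (1 + j)" using u by (simp add: mem_exceptional_units_iff algebra_simps)
      also have "\<dots> \<le> ?q * int p" using j q0 by (intro mult_left_mono) auto
      finally show ?thesis .
    qed
    ultimately show "u + ?q * j \<in> exceptional_units (p ^ Suc a)"
      using u j pos_a by (auto simp: mem_exceptional_units_iff mult.commute)
  qed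
  show "(\<lambda>u. (u mod ?q, u div ?q)) \<in> exceptional_units (p ^ Suc a) \<rightarrow> exceptional_units (p ^ a) \<times> {0..<int p}"
  proof
    fix u assume u: "u \<in> exceptional_units (p ^ Suc a)"
    have "u mod int (p ^ a) \<in> exceptional_units (p ^ a)"
      using u p0 by (intro exceptional_units_mod_mem) auto
    moreover have "u = ?q * (u div ?q) + u mod ?q" "0 \<le> u mod ?q" using q0 by simp_all
    hence "?q * (u div ?q) \<le> u" by linarith
    with u have "?q * (u div ?q) < ?q * int p" by (simp add: mem_exceptional_units_iff mult.commute)
    hence "u div ?q < int p" using q0 by simp
    moreover have "0 \<le> u div ?q"
      using u q0 by (simp add: mem_exceptional_units_iff pos_imp_zdiv_nonneg_iff)
    ultimately show "(u mod ?q, u div ?q) \<in> exceptional_units (p ^ a) \<times> {0..<int p}" by simp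
  qed
  show "(case (u mod ?q, u div ?q) of (u, j) \<Rightarrow> u + ?q * j) = u" for u by simp
  show "((case z of (u, j) \<Rightarrow> u + ?q * j) mod ?q, (case z of (u, j) \<Rightarrow> u + ?q * j) div ?q) = z"
    if "z \<in> exceptional_units (p ^ a) \<times> {0..<int p}" for z
    using that q0 by (auto simp: mem_exceptional_units_iff)
qed

text \<open>Hensel lifting for \<open>u^2 = c\<close>: the derivative \<open>2 * u\<close> is
  invertible modulo \<open>p\<close>, since \<open>p\<close> is odd and \<open>u\<close> is a unit,
  so each root lifts in exactly one way.\<close>

lemma bij_betw_square_roots_prime_power_Suc:
  "bij_betw (\<lambda>u. u mod int p ^ a) {u \<in> exceptional_units (p ^ Suc a). int (p ^ Suc a) dvd c - u^2}
     {u \<in> exceptional_units (p ^ a). int (p ^ a) dvd c - u^2}"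
  (is "bij_betw ?f ?A ?B")
proof (rule bij_betw_imageI)
  have p0: "0 < int p" using prime_p prime_gt_0_nat by simp
  have odd2: "coprime 2 (int p)" using odd_p by simp
  let ?q = "int p ^ a"
  have q0: "0 < ?q" using p0 by simp
  show "inj_on ?f ?A"
  proof (rule inj_onI)
    fix u v assume u: "u \<in> ?A" and v: "v \<in> ?A" and eq: "u mod ?q = v mod ?q"
    hence "?q dvd u - v" by (simp add: mod_eq_dvd_iff)
    hence uv: "int p dvd u - v" using pos_a by (metis dvd_power dvd_trans)
    have "coprime u (int p)" using u by (auto simp: mem_exceptional_units_iff)
    hence "coprime (2 * u) (int p)" using odd2 by simp
    \<comment> \<open>As \<open>u + v\<close> is prime to \<open>p\<close>, the full power of
      \<open>p\<close> dividing \<open>(u + v) * (u - v)\<close> must divide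
      \<open>u - v\<close>.\<close>
    moreover have "[2 * u = u + v] (mod int p)" using uv by (simp add: cong_iff_dvd_diff)
    ultimately have "coprime (int (p ^ Suc a)) (u + v)"
      using cong_imp_coprime[of "2 * u" "u + v" "int p"] by (simp add: coprime_commute)
    moreover have "int (p ^ Suc a) dvd (c - v^2) - (c - u^2)" using u v by (blast intro: dvd_diff)
    hence "int (p ^ Suc a) dvd (u + v) * (u - v)" by (simp add: algebra_simps power2_eq_square)
    ultimately have "int (p ^ Suc a) dvd u - v" by (simp only: coprime_dvd_mult_right_iff)
    thus "u = v" using u v
      by (metis (no_types, lifting) mem_Collect_eq mem_exceptional_units_iff mod_eq_dvd_iff mod_pos_pos_trivial)
  qed
  show "?f ` ?A = ?B"
  proof (intro equalityI subsetI)
    fix v assume "v \<in> ?f ` ?A"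
    then obtain u where u: "u \<in> ?A" and v: "v = u mod int (p ^ a)" by auto
    have "v \<in> exceptional_units (p ^ a)"
      unfolding v using u p0 by (intro exceptional_units_mod_mem[of _ "p ^ Suc a"]) auto
    moreover have "int (p ^ a) dvd int (p ^ Suc a)" by simp
    hence "int (p ^ a) dvd c - u^2" using u dvd_trans by blast
    hence "[c = u^2] (mod int (p ^ a))" by (simp add: cong_iff_dvd_diff)
    hence "[c = v^2] (mod int (p ^ a))" unfolding v by (simp add: cong_def power_mod)
    ultimately show "v \<in> ?B" by (simp add: cong_iff_dvd_diff)
  next
    fix v assume v: "v \<in> ?B"
    then obtain m where m: "c - v^2 = ?q * m" by auto
    have "coprime v (int p)" using v pos_a by (auto simp: mem_exceptional_units_iff)
    hence "coprime (2 * v) (int p)" using odd2 by simp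
    then obtain w where w: "[2 * v * w = 1] (mod int p)" using cong_solve_coprime_int by blast
    \<comment> \<open>With \<open>w\<close> inverse to \<open>2 * v\<close>, this digit solves
      \<open>2 * v * j = m\<close> modulo \<open>p\<close>, which cancels the linear term of
      \<open>c - (v + ?q * j)^2 = ?q * (m - 2 * v * j - ?q * j^2)\<close>. The quadratic term is
      harmless because \<open>p\<close> divides \<open>?q\<close>.\<close>
    define j where "j = (w * m) mod int p"
    define u where "u = v + ?q * j"
    have j: "j \<in> {0..<int p}" using p0 by (simp add: j_def)
    have "[2 * v * j = 2 * v * (w * m)] (mod int p)" by (intro cong_mult cong_refl) (simp add: j_def cong_def)
    also have "2 * v * (w * m) = 2 * v * w * m" by simp
    also have "[2 * v * w * m = 1 * m] (mod int p)" using w by (intro cong_mult cong_refl)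
    finally have "int p dvd m - 2 * v * j" by (simp add: cong_iff_dvd_diff dvd_diff_commute)
    moreover have "int p dvd ?q" using pos_a by simp
    ultimately have "int p dvd (m - 2 * v * j) - ?q * j^2" by (blast intro: dvd_diff dvd_mult2)
    hence "?q * int p dvd ?q * ((m - 2 * v * j) - ?q * j^2)" by (intro mult_dvd_mono) auto
    also have "?q * ((m - 2 * v * j) - ?q * j^2) = c - u^2"
      using m by (simp add: u_def power2_eq_square algebra_simps)
    finally have dv: "int (p ^ Suc a) dvd c - u^2" by (simp add: mult.commute)
    have "u \<in> exceptional_units (p ^ Suc a)"
      using bij_betw_apply[OF bij_betw_exceptional_units_prime_power_Suc, of "(v, j)"] v j
      by (simp add: u_def)
    hence "u \<in> ?A" using dv by simp
    moreover have "?f u = v" using v by (simp add: u_def mem_exceptional_units_iff)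
    ultimately show "v \<in> ?f ` ?A" by force
  qed
qed

text \<open>With a single coordinate the lift is unique. With more, the induction hypothesis lowers
  the modulus for the remaining coordinates; the split-off one then matters only modulo
  \<open>p ^ a\<close>, and each of its residues has \<open>p\<close> lifts.\<close>

lemma num_square_sums_prime_power_Suc:
  "num_square_sums (Suc k) c (p ^ Suc a) = p ^ k * num_square_sums (Suc k) c (p ^ a)"
proof (induction k arbitrary: c)
  case 0
  have "num_square_sums (Suc 0) c n = card {u \<in> exceptional_units n. int n dvd c - u^2}" for n
    by (simp add: num_square_sums_Suc num_square_sums_0 Int_def flip: sum.inter_filter)
  thus ?case using bij_betw_same_card[OF bij_betw_square_roots_prime_power_Suc] by simp
next
  case (Suc k)
  let ?q = "int p ^ a"
  have "num_square_sums (Suc (Suc k)) c (p ^ Suc a) =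
      p ^ k * (\<Sum>u\<in>exceptional_units (p ^ Suc a). num_square_sums (Suc k) (c - u^2) (p ^ a))"
    by (simp add: num_square_sums_Suc[of "Suc k"] Suc.IH sum_distrib_left del: power_Suc)
  also have "(\<Sum>u\<in>exceptional_units (p ^ Suc a). num_square_sums (Suc k) (c - u^2) (p ^ a)) =
      (\<Sum>(u, j)\<in>exceptional_units (p ^ a) \<times> {0..<int p}.
        num_square_sums (Suc k) (c - (u + ?q * j)^2) (p ^ a))"
    using sum.reindex_bij_betw[OF bij_betw_exceptional_units_prime_power_Suc,
        of "\<lambda>u. num_square_sums (Suc k) (c - u^2) (p ^ a)"]
    by (simp add: case_prod_unfold)
  also have "\<dots> = (\<Sum>(u, j)\<in>exceptional_units (p ^ a) \<times> {0..<int p}.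
        num_square_sums (Suc k) (c - u^2) (p ^ a))"
  proof (rule sum.cong[OF refl], clarify)
    fix u j :: int
    show "num_square_sums (Suc k) (c - (u + ?q * j)^2) (p ^ a) = num_square_sums (Suc k) (c - u^2) (p ^ a)"
      by (intro num_square_sums_cong cong_diff cong_refl cong_pow) (simp add: cong_iff_dvd_diff)
  qed
  also have "\<dots> = p * num_square_sums (Suc (Suc k)) c (p ^ a)"
    by (simp add: num_square_sums_Suc[of "Suc k"] sum_distrib_left flip: sum.cartesian_product)
  finally show ?case by simp
qed

end

lemma num_square_sums_prime_power:
  assumes "prime p" "odd p" "0 < a"
  shows "num_square_sums (Suc k) c (p ^ a) = p ^ (k * (a - 1)) * num_square_sums (Suc k) c p"
  using assms(3)
proof (induction a rule: nat_induct_non_zero)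
  case 1
  thus ?case by simp
next
  case (Suc a)
  obtain b where "a = Suc b" using Suc by (cases a) auto
  thus ?case using Suc num_square_sums_prime_power_Suc[OF assms(1,2) Suc.hyps, of k c]
    by (simp add: power_add algebra_simps)
qed

section \<open>Character sums modulo a prime\<close>

text \<open>An affine map with invertible slope permutes the residues. The shift by 1 serves
  orthogonality, the scaling by \<open>t\<close> serves the Gauss sum.\<close>

lemma sum_residues_affine:
  fixes f :: "int \<Rightarrow> 'a::comm_monoid_add"
  assumes "coprime a m" "0 < m" and f: "\<And>x y. [x = y] (mod m) \<Longrightarrow> f x = f y"
  shows "(\<Sum>x\<in>{0..<m}. f (a * x + b)) = (\<Sum>x\<in>{0..<m}. f x)"
proof -
  let ?g = "\<lambda>x. (a * x + b) mod m"
  have inj: "inj_on ?g {0..<m}"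
  proof (rule inj_onI)
    fix x y assume xy: "x \<in> {0..<m}" "y \<in> {0..<m}" "?g x = ?g y"
    hence "[a * x + b = a * y + b] (mod m)" by (simp add: cong_def)
    hence "[x = y] (mod m)" using assms(1)
      by (simp add: cong_add_rcancel cong_mult_lcancel)
    thus "x = y" using xy by (simp add: cong_def)
  qed
  moreover have "?g ` {0..<m} \<subseteq> {0..<m}" using assms(2) by auto
  ultimately have "bij_betw ?g {0..<m} {0..<m}"
    by (simp add: bij_betw_def endo_inj_surj)
  from sum.reindex_bij_betw[OF this, of f]
  have "(\<Sum>x\<in>{0..<m}. f (?g x)) = (\<Sum>x\<in>{0..<m}. f x)" .
  moreover have "f (?g x) = f (a * x + b)" for x by (rule f) (simp add: cong_def)
  ultimately show ?thesis by simp
qed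

text \<open>The character exp (2 pi i t / p), taken on all integers so that arguments such as
  \<open>- c * t\<close> need no reduction modulo \<open>p\<close>.\<close>

definition additive_char :: "nat \<Rightarrow> int \<Rightarrow> complex" where
  "additive_char p t = cis (2 * pi * (of_int t / of_nat p))"

lemma additive_char_add: "additive_char p (s + t) = additive_char p s * additive_char p t"
  by (simp add: additive_char_def cis_mult add_divide_distrib distrib_left)

lemma additive_char_0 [simp]: "additive_char p 0 = 1"
  by (simp add: additive_char_def)

lemma additive_char_power: "additive_char p t ^ j = additive_char p (int j * t)"
  by (induction j) (simp_all add: additive_char_add algebra_simps)

lemma additive_char_eq_1_iff:
  assumes "0 < p"
  shows "additive_char p t = 1 \<longleftrightarrow> int p dvd t"
proof
  assume "int p dvd t"
  then obtain s where "t = int p * s" by auto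
  thus "additive_char p t = 1" using assms by (simp add: additive_char_def)
next
  assume "additive_char p t = 1"
  hence "cos (2 * pi * (of_int t / of_nat p)) = 1"
    unfolding additive_char_def by (metis cis.simps(1) one_complex.simps(1))
  then obtain n :: int where "2 * pi * (of_int t / of_nat p) = of_int n * 2 * pi"
    using cos_one_2pi_int by blast
  hence "of_int t = (of_int (n * int p) :: real)" using assms by (simp add: field_simps)
  hence "t = n * int p" by (simp only: of_int_eq_iff)
  thus "int p dvd t" by simp
qed

lemma additive_char_cong:
  assumes "0 < p" "[s = t] (mod int p)"
  shows "additive_char p s = additive_char p t"
proof -
  have "additive_char p s = additive_char p (s - t) * additive_char p t"
    by (simp flip: additive_char_add)
  thus ?thesis using assms by (simp add: additive_char_eq_1_iff cong_iff_dvd_diff)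
qed

lemma sum_additive_char:
  assumes "0 < p"
  shows "(\<Sum>t\<in>{0..<int p}. additive_char p (t * a)) = (if int p dvd a then of_nat p else 0)"
proof (cases "int p dvd a")
  case True
  hence "additive_char p (t * a) = 1" for t using assms by (simp add: additive_char_eq_1_iff)
  thus ?thesis using True by simp
next
  case False
  let ?S = "\<Sum>t\<in>{0..<int p}. additive_char p (t * a)"
  \<comment> \<open>Replacing \<open>t\<close> by \<open>t + 1\<close> preserves the sum but
    multiplies it by \<open>additive_char p a\<close>, which differs from 1.\<close>
  have "additive_char p a * ?S = (\<Sum>t\<in>{0..<int p}. additive_char p ((1 * t + 1) * a))"
    by (simp add: sum_distrib_left algebra_simps flip: additive_char_add)
  also have "\<dots> = ?S"
    using assms by (intro sum_residues_affine additive_char_cong cong_mult) auto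
  finally have "(additive_char p a - 1) * ?S = 0" by (simp add: algebra_simps)
  thus ?thesis using False assms by (simp add: additive_char_eq_1_iff)
qed

definition gauss_sum :: "nat \<Rightarrow> complex" where
  "gauss_sum p = (\<Sum>y\<in>{0..<int p}. of_int (Legendre y (int p)) * additive_char p y)"

definition exceptional_gauss_sum :: "nat \<Rightarrow> int \<Rightarrow> complex" where
  "exceptional_gauss_sum p t = (\<Sum>x\<in>exceptional_units p. additive_char p (t * x^2))"

text \<open>Orthogonality is the case \<open>k = 0\<close>; each further coordinate \<open>u\<close>
  turns the target \<open>c - u^2\<close> into a factor \<open>additive_char p (t * u^2)\<close>,
  and summing over \<open>u\<close> gives one more factor
  \<open>exceptional_gauss_sum p t\<close>.\<close>

lemma num_square_sums_eq_char_sum: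
  assumes "0 < p"
  shows "of_nat p * of_nat (num_square_sums k c p) =
    (\<Sum>t\<in>{0..<int p}. additive_char p (- c * t) * exceptional_gauss_sum p t ^ k)"
proof (induction k arbitrary: c)
  case 0
  show ?case using sum_additive_char[OF assms, of "- c"]
    by (simp add: num_square_sums_0 mult.commute)
next
  case (Suc k)
  have "of_nat p * of_nat (num_square_sums (Suc k) c p) =
    (\<Sum>u\<in>exceptional_units p. \<Sum>t\<in>{0..<int p}.
       additive_char p (- (c - u^2) * t) * exceptional_gauss_sum p t ^ k)"
    by (simp add: num_square_sums_Suc sum_distrib_left Suc.IH)
  also have "\<dots> = (\<Sum>t\<in>{0..<int p}. \<Sum>u\<in>exceptional_units p.
       additive_char p (- c * t) * additive_char p (t * u^2) * exceptional_gauss_sum p t ^ k)"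
    by (subst sum.swap) (simp add: algebra_simps flip: additive_char_add)
  finally show ?case
    by (simp add: exceptional_gauss_sum_def sum_distrib_left sum_distrib_right mult_ac)
qed

text \<open>For \<open>k = 0\<close> the truncated \<open>(k - 1) div 2\<close> would wrongly admit
  the odd index 1, hence the assumption.\<close>

lemma sum_split_parity:
  fixes f :: "nat \<Rightarrow> 'a::comm_monoid_add"
  assumes "1 \<le> k"
  shows "(\<Sum>m\<le>k. f m) = (\<Sum>i=0..k div 2. f (2 * i)) + (\<Sum>i=0..(k - 1) div 2. f (2 * i + 1))"
proof -
  have "{..k} = (\<lambda>i. 2 * i) ` {0..k div 2} \<union> (\<lambda>i. 2 * i + 1) ` {0..(k - 1) div 2}"
  proof (intro equalityI subsetI)
    fix m assume "m \<in> {..k}"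
    moreover have "m = 2 * (m div 2) \<or> m = 2 * (m div 2) + 1" by linarith
    ultimately show "m \<in> (\<lambda>i. 2 * i) ` {0..k div 2} \<union> (\<lambda>i. 2 * i + 1) ` {0..(k - 1) div 2}"
      by (auto intro!: image_eqI[of _ _ "m div 2"] div_le_mono)
  qed (use assms in auto)
  moreover have "(\<lambda>i. 2 * i) ` {0..k div 2} \<inter> (\<lambda>i. 2 * i + 1) ` {0..(k - 1) div 2} = {}"
    by (auto dest: arg_cong[where f = even])
  ultimately have "(\<Sum>m\<le>k. f m) = sum f ((\<lambda>i. 2 * i) ` {0..k div 2}) + sum f ((\<lambda>i. 2 * i + 1) ` {0..(k - 1) div 2})"
    by (simp add: sum.union_disjoint)
  thus ?thesis by (simp add: sum.reindex inj_on_def)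
qed

text \<open>Powers of \<open>additive_char p t\<close> are again characters, so expanding the power
  leaves sums at the frequencies \<open>j - c\<close>. The weight \<open>g\<close> will be a power
  of the Legendre symbol.\<close>

lemma sum_additive_char_binomial:
  assumes "finite T"
  shows "(\<Sum>t\<in>T. additive_char p (- c * t) * g t * (1 + additive_char p t) ^ r) =
    (\<Sum>j\<le>r. of_nat (r choose j) * (\<Sum>t\<in>T. g t * additive_char p (t * (int j - c))))"
proof -
  have "(\<Sum>t\<in>T. additive_char p (- c * t) * g t * (1 + additive_char p t) ^ r) =
    (\<Sum>t\<in>T. \<Sum>j\<le>r. of_nat (r choose j) * (g t * additive_char p (t * (int j - c))))"
  proof (rule sum.cong[OF refl])
    fix t
    have "additive_char p (t * (int j - c)) = additive_char p (- c * t) * additive_char p t ^ j" for j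
      by (simp add: additive_char_power algebra_simps flip: additive_char_add)
    thus "additive_char p (- c * t) * g t * (1 + additive_char p t) ^ r =
        (\<Sum>j\<le>r. of_nat (r choose j) * (g t * additive_char p (t * (int j - c))))"
      using binomial_ring[of "additive_char p t" 1 r]
      by (simp add: add.commute sum_distrib_left mult_ac)
  qed
  also have "\<dots> = (\<Sum>j\<le>r. of_nat (r choose j) * (\<Sum>t\<in>T. g t * additive_char p (t * (int j - c))))"
    by (subst sum.swap) (simp add: sum_distrib_left)
  finally show ?thesis .
qed

section \<open>Legendre symbols and quadratic Gauss sums\<close>

context
  fixes p :: nat
  assumes prime_p: "prime p" and odd_p: "odd p"
begin

private lemma p_gt_2: "2 < p"
  using prime_p odd_p prime_ge_2_nat[of p] by (cases "p = 2") auto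

private lemma prime_int_p: "prime (int p)"
  using prime_p by simp

private lemma coprime_int_p_iff: "coprime u (int p) \<longleftrightarrow> \<not> int p dvd u"
proof
  show "coprime u (int p)" if "\<not> int p dvd u"
    using prime_imp_coprime[OF prime_int_p that] by (simp add: coprime_commute)
  show "\<not> int p dvd u" if "coprime u (int p)"
    using coprime_common_divisor[OF that, of "int p"] p_gt_2 by auto
qed

lemma Legendre_eq_0_iff: "Legendre a (int p) = 0 \<longleftrightarrow> int p dvd a"
  by (auto simp: Legendre_def cong_iff_dvd_diff)

lemma Legendre_cong: "[a = b] (mod int p) \<Longrightarrow> Legendre a (int p) = Legendre b (int p)"
proof -
  assume "[a = b] (mod int p)"
  hence "[x = a] (mod int p) \<longleftrightarrow> [x = b] (mod int p)" for x using cong_sym cong_trans by blast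
  moreover from this have "[a = 0] (mod int p) \<longleftrightarrow> [b = 0] (mod int p)" by (simp only: cong_sym_eq[of _ 0])
  ultimately show ?thesis by (simp add: Legendre_def QuadRes_def)
qed

lemma Legendre_values: "Legendre a (int p) \<in> {-1, 0, 1}"
  by (auto simp: Legendre_def)

text \<open>Two such values differ by at most 2, which is less than \<open>p\<close>. This turns the
  congruences of Euler's criterion into equalities.\<close>

lemma cong_small_eq:
  assumes "[x = y] (mod int p)" "x \<in> {-1, 0, 1}" "y \<in> {-1, 0, 1}"
  shows "x = y"
proof -
  have "int p dvd x - y" using assms(1) by (simp add: cong_iff_dvd_diff)
  moreover have "\<bar>x - y\<bar> < int p" using assms(2,3) p_gt_2 by auto
  ultimately show ?thesis using dvd_imp_le_int[of "x - y" "int p"] by force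
qed

lemma Legendre_mult: "Legendre (a * b) (int p) = Legendre a (int p) * Legendre b (int p)"
proof (rule cong_small_eq)
  note euler = euler_criterion[OF prime_p p_gt_2]
  have "[Legendre a (int p) * Legendre b (int p) = a ^ ((p - 1) div 2) * b ^ ((p - 1) div 2)] (mod int p)"
    by (intro cong_mult euler)
  with euler[of "a * b"] show "[Legendre (a * b) (int p) = Legendre a (int p) * Legendre b (int p)] (mod int p)"
    by (metis cong_sym cong_trans power_mult_distrib)
qed (use Legendre_values[of a] Legendre_values[of b] Legendre_values[of "a * b"] in auto)

lemma Legendre_minus_1: "Legendre (- 1) (int p) = (- 1) ^ ((p - 1) div 2)"
  using euler_criterion[OF prime_p p_gt_2, of "- 1"] Legendre_values[of "-1"]
  by (intro cong_small_eq) (auto simp: minus_one_power_iff)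

lemma card_square_roots:
  "int (card {x \<in> {0..<int p}. [x^2 = y] (mod int p)}) = 1 + Legendre y (int p)"
proof (cases "int p dvd y")
  case True
  have "int p dvd x^2 - y \<longleftrightarrow> int p dvd x" for x
    using dvd_add_left_iff[OF True, of "x^2 - y"] prime_dvd_power_iff[OF prime_int_p, of 2 x] by simp
  hence "{x \<in> {0..<int p}. [x^2 = y] (mod int p)} = {0}"
    using p_gt_2 by (auto simp: cong_iff_dvd_diff dest: zdvd_imp_le)
  thus ?thesis using True by (simp add: Legendre_eq_0_iff[THEN iffD2])
next
  case False
  show ?thesis
  proof (cases "QuadRes (int p) y")
    case True
    then obtain z' where "[z'^2 = y] (mod int p)" by (auto simp: QuadRes_def)
    define z where "z = z' mod int p"
    have z: "[z^2 = y] (mod int p)"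
      using \<open>[z'^2 = y] (mod int p)\<close> by (simp add: z_def cong_def power_mod)
    have zr: "0 \<le> z" "z < int p" using p_gt_2 by (simp_all add: z_def)
    have "\<not> int p dvd z"
    proof
      assume "int p dvd z"
      hence "int p dvd z^2" by (simp add: power2_eq_square)
      thus False using z False by (simp add: cong_dvd_iff)
    qed
    hence z0: "z \<noteq> 0" by auto
    have "x = z \<or> x = int p - z" if "x \<in> {0..<int p}" "[x^2 = y] (mod int p)" for x
    proof -
      have "[x^2 = z^2] (mod int p)" using that(2) z cong_sym cong_trans by blast
      hence "int p dvd (x - z) * (x + z)" by (simp add: cong_iff_dvd_diff power2_eq_square algebra_simps)
      hence "int p dvd x - z \<or> int p dvd x + z"
        using prime_dvd_mult_iff[OF prime_int_p] by simp
      thus ?thesis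
      proof
        assume "int p dvd x - z"
        hence "[x = z] (mod int p)" by (simp add: cong_iff_dvd_diff)
        thus ?thesis using that(1) zr by (simp add: cong_def)
      next
        assume "int p dvd x + z"
        hence "int p dvd (x + z) - int p" by (rule dvd_diff) simp
        hence "[x = int p - z] (mod int p)" by (simp add: cong_iff_dvd_diff algebra_simps)
        thus ?thesis using that(1) zr z0 cong_less_imp_eq_int[of x "int p" "int p - z"] by simp
      qed
    qed
    moreover have "[(int p - z)^2 = y] (mod int p)"
    proof -
      have "[(int p - z)^2 = (- z)^2] (mod int p)" by (intro cong_pow) (simp add: cong_iff_dvd_diff)
      thus ?thesis using z cong_trans by auto
    qed
    ultimately have "{x \<in> {0..<int p}. [x^2 = y] (mod int p)} = {z, int p - z}"
      using z zr z0 by auto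
    moreover have "z \<noteq> int p - z" using odd_p by presburger
    moreover have "Legendre y (int p) = 1" using True False by (auto simp: Legendre_def cong_iff_dvd_diff)
    ultimately show ?thesis by simp
  next
    case nres: False
    hence "{x \<in> {0..<int p}. [x^2 = y] (mod int p)} = {}" by (auto simp: QuadRes_def)
    moreover have "Legendre y (int p) = - 1" using nres False by (auto simp: Legendre_def cong_iff_dvd_diff)
    ultimately show ?thesis by (simp only: card.empty)
  qed
qed

text \<open>Group the \<open>x\<close> by the residue \<open>y\<close> of their square; the fibre
  sizes are given by \<open>card_square_roots\<close>.\<close>

lemma sum_squares_eq_Legendre_sum:
  fixes f :: "int \<Rightarrow> complex"
  assumes f: "\<And>x y. [x = y] (mod int p) \<Longrightarrow> f x = f y"
  shows "(\<Sum>x\<in>{0..<int p}. f (x^2)) =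
    (\<Sum>y\<in>{0..<int p}. (1 + of_int (Legendre y (int p))) * f y)"
proof -
  have "(\<Sum>x\<in>{0..<int p}. f (x^2)) =
    (\<Sum>y\<in>{0..<int p}. \<Sum>x | x \<in> {0..<int p} \<and> x^2 mod int p = y. f (x^2))"
    using p_gt_2 by (intro sum.group[symmetric]) auto
  also have "\<dots> = (\<Sum>y\<in>{0..<int p}. (1 + of_int (Legendre y (int p))) * f y)"
  proof (rule sum.cong[OF refl])
    fix y assume y: "y \<in> {0..<int p}"
    have "(\<Sum>x | x \<in> {0..<int p} \<and> x^2 mod int p = y. f (x^2)) =
      (\<Sum>x | x \<in> {0..<int p} \<and> [x^2 = y] (mod int p). f y)"
      using y by (intro sum.cong f) (auto simp: cong_def)
    also have "\<dots> = of_int (int (card {x \<in> {0..<int p}. [x^2 = y] (mod int p)})) * f y"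
      by simp
    finally show "(\<Sum>x | x \<in> {0..<int p} \<and> x^2 mod int p = y. f (x^2)) =
        (1 + of_int (Legendre y (int p))) * f y"
      by (simp only: card_square_roots) simp
  qed
  finally show ?thesis .
qed

lemma sum_Legendre: "(\<Sum>y\<in>{0..<int p}. of_int (Legendre y (int p)) :: complex) = 0"
  using sum_squares_eq_Legendre_sum[of "\<lambda>_. 1"] by (simp add: sum.distrib)

text \<open>For \<open>t\<close> prime to \<open>p\<close>, scaling the variable of the Gauss sum by
  \<open>t\<close> pulls out the symbol of \<open>t\<close>, whose square is 1. Otherwise both sides
  vanish by \<open>sum_Legendre\<close>.\<close>

lemma sum_Legendre_additive_char:
  "(\<Sum>y\<in>{0..<int p}. of_int (Legendre y (int p)) * additive_char p (y * t)) =
     of_int (Legendre t (int p)) * gauss_sum p"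
  (is "?S = _")
proof (cases "int p dvd t")
  case True
  hence "additive_char p (y * t) = 1" for y using p_gt_2 by (simp add: additive_char_eq_1_iff)
  thus ?thesis using True sum_Legendre by (simp add: Legendre_eq_0_iff[THEN iffD2])
next
  case False
  let ?L = "\<lambda>a. of_int (Legendre a (int p)) :: complex"
  have LL: "?L t * ?L t = 1"
    using Legendre_values[of t] False by (auto simp: Legendre_eq_0_iff)
  have "coprime t (int p)"
    using False by (simp add: coprime_int_p_iff)
  hence "gauss_sum p = (\<Sum>y\<in>{0..<int p}. ?L (t * y + 0) * additive_char p (t * y + 0))"
    unfolding gauss_sum_def using p_gt_2
    by (intro sum_residues_affine[symmetric]) (auto simp: Legendre_cong additive_char_cong)
  also have "\<dots> = ?L t * ?S"
    by (simp add: Legendre_mult sum_distrib_left mult_ac)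
  finally show ?thesis using LL by (simp flip: mult.assoc)
qed

text \<open>One factor \<open>gauss_sum p\<close> is absorbed into a twisted sum by
  \<open>sum_Legendre_additive_char\<close>. After swapping the sums, orthogonality leaves only
  \<open>y = -1\<close> modulo \<open>p\<close>, represented by \<open>p - 1\<close>.\<close>

lemma gauss_sum_square: "gauss_sum p ^ 2 = (- 1) ^ ((p - 1) div 2) * of_nat p"
proof -
  let ?L = "\<lambda>a. of_int (Legendre a (int p)) :: complex"
  have "gauss_sum p ^ 2 = (\<Sum>x\<in>{0..<int p}. additive_char p x * (?L x * gauss_sum p))"
    unfolding power2_eq_square by (subst (1) gauss_sum_def) (simp add: sum_distrib_left sum_distrib_right mult_ac)
  also have "\<dots> = (\<Sum>x\<in>{0..<int p}. \<Sum>y\<in>{0..<int p}. ?L y * additive_char p (x * (1 + y)))"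
    unfolding sum_Legendre_additive_char[symmetric]
    by (simp add: sum_distrib_left distrib_left additive_char_add mult_ac)
  also have "\<dots> = (\<Sum>y\<in>{0..<int p}. ?L y * (if int p dvd 1 + y then of_nat p else 0))"
    using p_gt_2 by (subst sum.swap) (simp add: sum_additive_char flip: sum_distrib_left)
  also have "\<dots> = (\<Sum>y\<in>{0..<int p}. if y = int p - 1 then ?L y * of_nat p else 0)"
  proof (rule sum.cong[OF refl])
    fix y assume "y \<in> {0..<int p}"
    hence "int p dvd 1 + y \<longleftrightarrow> y = int p - 1" by (auto dest: zdvd_imp_le)
    thus "?L y * (if int p dvd 1 + y then of_nat p else 0) =
        (if y = int p - 1 then ?L y * of_nat p else 0)" by simp
  qed
  also have "\<dots> = ?L (int p - 1) * of_nat p" using p_gt_2 by simp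
  also have "Legendre (int p - 1) (int p) = Legendre (- 1) (int p)"
    by (rule Legendre_cong) (simp add: cong_iff_dvd_diff)
  finally show ?thesis by (simp add: Legendre_minus_1)
qed

section \<open>Exponential sums over exceptional units modulo \<open>p\<close>\<close>

lemma exceptional_units_prime: "exceptional_units p = {0..<int p} - {0, 1}"
proof (intro equalityI subsetI)
  fix u assume "u \<in> exceptional_units p"
  thus "u \<in> {0..<int p} - {0, 1}"
    using p_gt_2 by (auto simp: mem_exceptional_units_iff coprime_int_p_iff)
next
  fix u assume "u \<in> {0..<int p} - {0, 1}"
  hence u: "1 < u" "u < int p" by auto
  hence "\<not> int p dvd u" "\<not> int p dvd u - 1" by (auto dest: zdvd_imp_le)
  moreover have "int p dvd 1 - u \<longleftrightarrow> int p dvd u - 1" by (rule dvd_diff_commute)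
  ultimately show "u \<in> exceptional_units p"
    using u by (simp add: mem_exceptional_units_iff coprime_int_p_iff)
qed

lemma exceptional_gauss_sum_prime:
  "exceptional_gauss_sum p t =
    (\<Sum>x\<in>{0..<int p}. additive_char p (t * x^2)) - 1 - additive_char p t"
  using p_gt_2 by (simp add: exceptional_gauss_sum_def exceptional_units_prime sum_diff)

lemma exceptional_gauss_sum_0: "exceptional_gauss_sum p 0 = of_nat p - 2"
  by (simp add: exceptional_gauss_sum_prime)

text \<open>The complete sum of characters vanishes and the Legendre part gives the Gauss sum. The
  outer sign and the grouping prepare the \<open>k\<close>-th power: a factor
  \<open>(- 1) ^ k\<close> and a binomial expansion in two terms.\<close>

lemma exceptional_gauss_sum_nonzero:
  assumes "\<not> int p dvd t"
  shows "exceptional_gauss_sum p t =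
    - (- (of_int (Legendre t (int p)) * gauss_sum p) + (1 + additive_char p t))"
proof -
  have "(\<Sum>x\<in>{0..<int p}. additive_char p (t * x^2)) =
    (\<Sum>y\<in>{0..<int p}. (1 + of_int (Legendre y (int p))) * additive_char p (t * y))"
    using p_gt_2
    by (intro sum_squares_eq_Legendre_sum[of "\<lambda>x. additive_char p (t * x)"] additive_char_cong cong_mult) auto
  also have "\<dots> = (\<Sum>y\<in>{0..<int p}. additive_char p (y * t)) +
     (\<Sum>y\<in>{0..<int p}. of_int (Legendre y (int p)) * additive_char p (y * t))"
    by (simp add: algebra_simps sum.distrib)
  also have "\<dots> = of_int (Legendre t (int p)) * gauss_sum p"
    using assms p_gt_2 by (simp add: sum_additive_char sum_Legendre_additive_char)
  finally show ?thesis by (simp add: exceptional_gauss_sum_prime)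
qed

private lemma sum_nonzero_residues:
  fixes f :: "int \<Rightarrow> complex"
  shows "(\<Sum>t\<in>{0..<int p} - {0}. f t) = (\<Sum>t\<in>{0..<int p}. f t) - f 0"
  using p_gt_2 by (simp add: sum_diff1)

text \<open>An even power of the symbol is 1 at nonzero \<open>t\<close>, so orthogonality applies.
  The missing term \<open>t = 0\<close> costs the full binomial sum \<open>2 ^ r\<close>.\<close>

lemma sum_even_terms:
  "(\<Sum>t\<in>{0..<int p} - {0}. additive_char p (- c * t) * of_int (Legendre t (int p)) ^ (2 * i) *
      (1 + additive_char p t) ^ r) =
    of_nat p * (\<Sum>j | j \<le> r \<and> int p dvd int j - c. of_nat (r choose j)) - 2 ^ r"
proof -
  have L: "of_int (Legendre t (int p)) ^ (2 * i) = (1 :: complex)" if t: "t \<in> {0..<int p} - {0}" for t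
  proof -
    have "\<not> int p dvd t" using t by (auto dest: zdvd_imp_le)
    hence "Legendre t (int p) = 1 \<or> Legendre t (int p) = - 1"
      using Legendre_values[of t] prime_p odd_p by (auto simp: Legendre_eq_0_iff)
    thus ?thesis by auto
  qed
  have "(\<Sum>t\<in>{0..<int p} - {0}. additive_char p (- c * t) * of_int (Legendre t (int p)) ^ (2 * i) *
      (1 + additive_char p t) ^ r) =
    (\<Sum>t\<in>{0..<int p} - {0}. additive_char p (- c * t) * 1 * (1 + additive_char p t) ^ r)"
    by (intro sum.cong refl) (simp add: L del: of_int_power)
  also have "\<dots> = (\<Sum>j\<le>r. of_nat (r choose j) * ((if int p dvd int j - c then of_nat p else 0) - 1))"
    using p_gt_2
    by (subst sum_additive_char_binomial) (simp_all add: sum_nonzero_residues sum_additive_char)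
  also have "\<dots> = (\<Sum>j\<le>r. if int p dvd int j - c then of_nat p * of_nat (r choose j) else 0) -
      (\<Sum>j\<le>r. of_nat (r choose j))"
    unfolding sum_subtractf[symmetric] by (intro sum.cong) (auto simp: algebra_simps)
  also have "(\<Sum>j\<le>r. of_nat (r choose j)) = (2 ^ r :: complex)"
    by (simp flip: of_nat_sum choose_row_sum)
  also have "(\<Sum>j\<le>r. if int p dvd int j - c then of_nat p * of_nat (r choose j) else 0) =
      of_nat p * (\<Sum>j | j \<le> r \<and> int p dvd int j - c. of_nat (r choose j) :: complex)"
    by (simp add: sum_distrib_left flip: sum.inter_filter)
  finally show ?thesis .
qed

text \<open>An odd power of the symbol is the symbol itself, so the sum over \<open>t\<close> is a
  twisted Gauss sum. Omitting \<open>t = 0\<close> is free because the symbol vanishes there; the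
  same holds for the \<open>j\<close> with \<open>p\<close> dividing \<open>j - c\<close>.\<close>

lemma sum_odd_terms:
  "(\<Sum>t\<in>{0..<int p} - {0}. additive_char p (- c * t) * of_int (Legendre t (int p)) ^ (2 * i + 1) *
      (1 + additive_char p t) ^ r) =
    gauss_sum p * (\<Sum>j | j \<le> r \<and> \<not> int p dvd int j - c.
      of_nat (r choose j) * of_int (Legendre (int j - c) (int p)))"
proof -
  have L: "of_int (Legendre t (int p)) ^ (2 * i + 1) = (of_int (Legendre t (int p)) :: complex)" for t
    by (auto simp: Legendre_def)
  have zero: "Legendre 0 (int p) = 0" using prime_p odd_p by (simp add: Legendre_eq_0_iff)
  have "(\<Sum>t\<in>{0..<int p} - {0}. additive_char p (- c * t) * of_int (Legendre t (int p)) ^ (2 * i + 1) *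
      (1 + additive_char p t) ^ r) =
    (\<Sum>j\<le>r. of_nat (r choose j) * (of_int (Legendre (int j - c) (int p)) * gauss_sum p))"
    unfolding L using prime_p odd_p
    by (subst sum_additive_char_binomial)
      (simp_all add: sum_nonzero_residues sum_Legendre_additive_char zero)
  also have "\<dots> = gauss_sum p * (\<Sum>j\<le>r. of_nat (r choose j) * of_int (Legendre (int j - c) (int p)))"
    by (simp add: sum_distrib_left mult_ac)
  also have "(\<Sum>j\<le>r. of_nat (r choose j) * of_int (Legendre (int j - c) (int p))) =
      (\<Sum>j | j \<le> r \<and> \<not> int p dvd int j - c.
        of_nat (r choose j) * (of_int (Legendre (int j - c) (int p)) :: complex))"
    using prime_p odd_p by (intro sum.mono_neutral_right) (auto simp: Legendre_eq_0_iff)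
  finally show ?thesis .
qed

lemma gauss_sum_even_power:
  "gauss_sum p ^ (2 * i) = (- 1) ^ ((p - 1) * i div 2) * of_nat p ^ i"
proof -
  have "(p - 1) * i div 2 = (p - 1) div 2 * i" using odd_p by (auto elim!: oddE)
  thus ?thesis by (simp add: power_mult gauss_sum_square prime_p odd_p power_mult_distrib)
qed

text \<open>The frequency \<open>t = 0\<close> contributes \<open>(p - 2) ^ k\<close>. For the
  others the \<open>k\<close>-th power is expanded in powers of the Gauss sum, and the even and odd
  exponents give the two subtracted sums.\<close>

lemma num_square_sums_prime:
  assumes "1 \<le> k"
  shows "real p * real (num_square_sums k c p) = (- 1) ^ k *
          ((2 - real p) ^ k
           - (\<Sum>i = 0..k div 2.
                (-1) ^ ((p - 1) * i div 2) * real p ^ i * real (k choose (2 * i)) *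
                (2 ^ (k - 2 * i)
                 - real p * (\<Sum>j | j \<le> k - 2 * i \<and> int p dvd int j - c.
                               real ((k - 2 * i) choose j))))
           - (\<Sum>i = 0..(k - 1) div 2.
                (-1) ^ ((p - 1) * (i + 1) div 2) * real p ^ (i + 1) *
                real (k choose (2 * i + 1)) *
                (\<Sum>j | j \<le> k - 2 * i - 1 \<and> \<not> int p dvd int j - c.
                   real ((k - 2 * i - 1) choose j) *
                   real_of_int (Legendre (int j - c) (int p)))))"
  (is "_ = (- 1) ^ k * (_ - (\<Sum>i = 0.._. ?e i) - (\<Sum>i = 0.._. ?o i))")
proof -
  let ?G = "gauss_sum p" and ?T = "{0..<int p} - {0}"
  define \<chi> :: "int \<Rightarrow> complex" where "\<chi> t = of_int (Legendre t (int p))" for t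
  \<comment> \<open>The coefficient of \<open>(- ?G) ^ m\<close> in the expansion, up to the
    binomial coefficient and the global sign.\<close>
  define A where "A m = (\<Sum>t\<in>?T. additive_char p (- c * t) * \<chi> t ^ m * (1 + additive_char p t) ^ (k - m))" for m
  have even_term: "of_nat (k choose (2 * i)) * (- ?G) ^ (2 * i) * A (2 * i) = - of_real (?e i)" for i
  proof -
    have "(- ?G) ^ (2 * i) = ?G ^ (2 * i)" by (simp only: power_minus_even even_mult_iff even_numeral simp_thms)
    moreover have "A (2 * i) =
        of_nat p * (\<Sum>j | j \<le> k - 2 * i \<and> int p dvd int j - c. of_nat ((k - 2 * i) choose j)) - 2 ^ (k - 2 * i)"
      unfolding A_def \<chi>_def by (rule sum_even_terms)
    ultimately have "of_nat (k choose (2 * i)) * (- ?G) ^ (2 * i) * A (2 * i) =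
        of_nat (k choose (2 * i)) * ((- 1) ^ ((p - 1) * i div 2) * of_nat p ^ i) *
        (of_nat p * (\<Sum>j | j \<le> k - 2 * i \<and> int p dvd int j - c. of_nat ((k - 2 * i) choose j)) - 2 ^ (k - 2 * i))"
      by (simp only: gauss_sum_even_power)
    also have "\<dots> = - of_real (?e i)" by (simp add: right_diff_distrib mult_ac)
    finally show ?thesis .
  qed
  have odd_term: "of_nat (k choose (2 * i + 1)) * (- ?G) ^ (2 * i + 1) * A (2 * i + 1) = - of_real (?o i)" for i
  proof -
    \<comment> \<open>The extra \<open>?G\<close> supplied by \<open>sum_odd_terms\<close> makes the
      exponent even; this is the source of \<open>i + 1\<close> in the formula.\<close>
    have "(- ?G) ^ (2 * i + 1) * ?G = - (?G ^ (2 * (i + 1)))" by (simp add: power_mult power2_eq_square)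
    moreover have "A (2 * i + 1) = ?G * (\<Sum>j | j \<le> k - 2 * i - 1 \<and> \<not> int p dvd int j - c.
      of_nat ((k - 2 * i - 1) choose j) * of_int (Legendre (int j - c) (int p)))" (is "_ = _ * ?s")
      using sum_odd_terms[of c i "k - (2 * i + 1)"] by (simp add: A_def \<chi>_def)
    ultimately have "of_nat (k choose (2 * i + 1)) * (- ?G) ^ (2 * i + 1) * A (2 * i + 1) =
        - (of_nat (k choose (2 * i + 1)) * ?G ^ (2 * (i + 1)) * ?s)"
      by (metis (no_types, lifting) mult.assoc mult_minus_left mult_minus_right)
    also have "\<dots> = - of_real (?o i)"
      unfolding gauss_sum_even_power by (simp add: mult_ac)
    finally show ?thesis .
  qed
  have "of_nat p * of_nat (num_square_sums k c p) =
      (\<Sum>t\<in>?T. additive_char p (- c * t) * exceptional_gauss_sum p t ^ k) + (of_nat p - 2) ^ k"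
    using p_gt_2 prime_p odd_p
    by (simp add: num_square_sums_eq_char_sum sum_nonzero_residues exceptional_gauss_sum_0)
  also have "(\<Sum>t\<in>?T. additive_char p (- c * t) * exceptional_gauss_sum p t ^ k) =
      (\<Sum>t\<in>?T. \<Sum>m\<le>k. (- 1) ^ k * (of_nat (k choose m) * (- ?G) ^ m *
        (additive_char p (- c * t) * \<chi> t ^ m * (1 + additive_char p t) ^ (k - m))))"
  proof (rule sum.cong[OF refl])
    fix t assume t: "t \<in> ?T"
    hence "\<not> int p dvd t" by (auto dest: zdvd_imp_le)
    hence "exceptional_gauss_sum p t = - (- ?G * \<chi> t + (1 + additive_char p t))"
      using exceptional_gauss_sum_nonzero by (simp add: \<chi>_def mult.commute)
    hence "exceptional_gauss_sum p t ^ k = (- 1) ^ k * (- ?G * \<chi> t + (1 + additive_char p t)) ^ k"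
      by (simp only: power_minus[of "- ?G * \<chi> t + (1 + additive_char p t)"])
    also have "(- ?G * \<chi> t + (1 + additive_char p t)) ^ k =
        (\<Sum>m\<le>k. of_nat (k choose m) * ((- ?G) ^ m * \<chi> t ^ m) * (1 + additive_char p t) ^ (k - m))"
      by (simp only: binomial_ring power_mult_distrib)
    finally show "additive_char p (- c * t) * exceptional_gauss_sum p t ^ k =
        (\<Sum>m\<le>k. (- 1) ^ k * (of_nat (k choose m) * (- ?G) ^ m *
        (additive_char p (- c * t) * \<chi> t ^ m * (1 + additive_char p t) ^ (k - m))))"
      by (simp only: sum_distrib_left mult_ac)
  qed
  also have "\<dots> = (- 1) ^ k * (\<Sum>m\<le>k. of_nat (k choose m) * (- ?G) ^ m * A m)"
    unfolding A_def by (subst sum.swap) (simp only: sum_distrib_left)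
  also have "(\<Sum>m\<le>k. of_nat (k choose m) * (- ?G) ^ m * A m) =
      (\<Sum>i=0..k div 2. of_nat (k choose (2 * i)) * (- ?G) ^ (2 * i) * A (2 * i)) +
      (\<Sum>i=0..(k - 1) div 2. of_nat (k choose (2 * i + 1)) * (- ?G) ^ (2 * i + 1) * A (2 * i + 1))"
    by (rule sum_split_parity[OF assms])
  also have "\<dots> = - of_real (\<Sum>i=0..k div 2. ?e i) + - of_real (\<Sum>i=0..(k - 1) div 2. ?o i)"
    by (simp only: even_term odd_term sum_negf of_real_sum)
  also have "(of_nat p - 2 :: complex) ^ k = (- 1) ^ k * of_real ((2 - real p) ^ k)"
    by (simp flip: power_mult_distrib)
  also have "(- 1) ^ k * (- of_real x + - of_real y) + (- 1) ^ k * of_real z =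
      complex_of_real ((- 1) ^ k * (z - x - y))" for x y z
    by (simp add: algebra_simps)
  finally have "complex_of_real (real p * real (num_square_sums k c p)) =
     complex_of_real ((- 1) ^ k * ((2 - real p) ^ k - (\<Sum>i = 0..k div 2. ?e i) - (\<Sum>i = 0..(k - 1) div 2. ?o i)))"
    by (simp only: of_real_mult of_real_of_nat_eq)
  thus ?thesis by (simp only: of_real_eq_iff)
qed

end

section \<open>Assembly of the local factors\<close>

theorem theorem1p1:
  fixes n k :: nat and c :: int
  assumes "n \<ge> 1" and "k \<ge> 2"
  shows "(even n \<longrightarrow> num_square_sums k c n = 0) \<and>
    (odd n \<longrightarrow>
      real (num_square_sums k c n) =
        (-1) ^ (k * omega n) *
        (\<Prod>p | prime p \<and> p dvd n.
          real p powi (int k * int (multiplicity p n) - int (multiplicity p n) - int k) *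
          ((2 - real p) ^ k
           - (\<Sum>i = 0..k div 2.
                (-1) ^ ((p - 1) * i div 2) * real p ^ i * real (k choose (2 * i)) *
                (2 ^ (k - 2 * i)
                 - real p * (\<Sum>j | j \<le> k - 2 * i \<and> int p dvd int j - c.
                               real ((k - 2 * i) choose j))))
           - (\<Sum>i = 0..(k - 1) div 2.
                (-1) ^ ((p - 1) * (i + 1) div 2) * real p ^ (i + 1) *
                real (k choose (2 * i + 1)) *
                (\<Sum>j | j \<le> k - 2 * i - 1 \<and> \<not> int p dvd int j - c.
                   real ((k - 2 * i - 1) choose j) *
                   real_of_int (Legendre (int j - c) (int p)))))))"
  (is "_ \<and> (_ \<longrightarrow> _ = _ * (\<Prod>p | _ p. ?w p * ?R p))")
proof (intro conjI impI)
  assume "even n"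
  thus "num_square_sums k c n = 0" using assms(2) by (intro num_square_sums_even) auto
next
  assume odd: "odd n"
  let ?P = "{p. prime p \<and> p dvd n}"
  have local_factor: "real (num_square_sums k c (p ^ multiplicity p n)) = (- 1) ^ k * (?w p * ?R p)"
    if p: "p \<in> ?P" for p
  proof -
    define a where "a = multiplicity p n"
    have pr: "prime p" "odd p" and p0: "real p > 0"
      using p odd by (auto intro: dvd_trans simp: prime_gt_0_nat)
    have a: "0 < a" using p assms(1) by (auto simp: a_def prime_multiplicity_gt_zero_iff)
    obtain l where l: "k = Suc l" using assms(2) by (cases k) auto
    \<comment> \<open>The part \<open>l * (a - 1)\<close> comes from lifting \<open>p\<close> to
      \<open>p ^ a\<close>, and the \<open>- 1\<close> from the factor \<open>p\<close> in
      \<open>num_square_sums_prime\<close>. For \<open>a = 1\<close> the exponent is negative, hence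
      \<open>powi\<close>.\<close>
    have "int k * int a - int a - int k = int (l * (a - 1)) - 1"
      using a by (simp add: l of_nat_diff algebra_simps)
    hence w: "?w p = real p ^ (l * (a - 1)) / real p"
      using p0 power_int_diff[of "real p" "int (l * (a - 1))" 1]
      unfolding a_def[symmetric] by (simp only: power_int_of_nat) simp
    have N: "real (num_square_sums k c p) = (- 1) ^ k * ?R p / real p"
      using num_square_sums_prime[OF pr, of k c] assms(2) p0 by (simp only: field_simps)
    have "real (num_square_sums k c (p ^ a)) = real p ^ (l * (a - 1)) * real (num_square_sums k c p)"
      using num_square_sums_prime_power[OF pr a, of l c] by (simp add: l)
    also have "\<dots> = (- 1) ^ k * (?w p * ?R p)" unfolding w N by (simp only: times_divide_eq_right times_divide_eq_left mult_ac)
    finally show ?thesis unfolding a_def .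
  qed
  have "real (num_square_sums k c n) = (\<Prod>p\<in>?P. real (num_square_sums k c (p ^ multiplicity p n)))"
    using assms(1) num_square_sums_prod_prime_powers[of n k c] by simp
  also have "\<dots> = (\<Prod>p\<in>?P. (- 1) ^ k * (?w p * ?R p))"
    by (rule prod.cong[OF refl local_factor])
  \<comment> \<open>Each prime divisor contributes one sign \<open>(- 1) ^ k\<close>.\<close>
  also have "\<dots> = (- 1) ^ (k * omega n) * (\<Prod>p\<in>?P. ?w p * ?R p)"
    by (simp only: prod.distrib prod_constant omega_def power_mult)
  finally show "real (num_square_sums k c n) = (- 1) ^ (k * omega n) * (\<Prod>p\<in>?P. ?w p * ?R p)" .
qed

end
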